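(* Assume that $\epsilon\le \beta\min_{i\in A^*}|x_i^*|$ for some $0\le\beta<1/2$. (a) Suppose $\nu<\frac{1-2\beta}{3T-1}$ and $\beta\le\frac{1-2(T-1)\nu}{T+3}$, and let $$\xi=\frac{1-2(T-1)\nu-2\beta-\beta^2}{2T}\,\min_{i\in A^*}|x_i^*|^2 .$$ Then for any $\lambda\in(\epsilon^2/2,\xi)$, the oracle solution $x^o$ is the only global minimizer of $J_\lambda$ over $\mathbb{R}^p$. (b) Suppose $\delta:=\delta_{2T}\le\frac{1-2\beta}{2\sqrt{T}+1}$ and $\beta\le\frac{1-2\delta-\delta^2}{4}$, and let $$\xi=\left[\frac12(1-\delta)-\frac{\delta^2}{1-\delta}-\frac{\beta}{\sqrt{1-\delta}}-\frac12\beta^2\right]\min_{i\in A^*}|x_i^*|^2 .$$ Then for any $\lambda\in(\epsilon^2/2,\xi)$, the oracle solution $x^o$ is the only global minimizer of $J_\lambda$ over $\mathbb{R}^p$.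
   Context: Setting: $\Psi\in\mathbb{R}^{n\times p}$, $p>n$, is a real matrix whose columns $\psi_1,\dots,\psi_p$ are normalized, $\|\psi_i\|=1$ (here $\|\cdot\|$ is the Euclidean norm). The true signal $x^*\in\mathbb{R}^p$ has support $A^*=\{i:x_i^*\ne0\}$ with $T=|A^*|\ge1$. The data are $y=\sum_{i\in A^*}x_i^*\psi_i+\eta\in\mathbb{R}^n$, where the noise $\eta\in\mathbb{R}^n$ satisfies $\|\eta\|\le\epsilon$ with noise level $\epsilon\ge0$. For an index set $A\subseteq\{1,\dots,p\}$, $\Psi_A$ is the submatrix of $\Psi$ with columns indexed by $A$, $x_A$ is the subvector of $x$ indexed by $A$, and $\Psi_A^\dagger$ is the pseudoinverse of $\Psi_A$, equal to $(\Psi_A^t\Psi_A)^{-1}\Psi_A^t$ when $\Psi_A^t\Psi_A$ is invertible. The oracle solution $x^o\in\mathbb{R}^p$ is given by $x^o=\Psi_{A^*}^\dagger y$ on $A^*$ and zero off $A^*$. Mutual coherence: $\nu=\max_{i\ne j}|\psi_i^t\psi_j|$. Restricted isometry constant: $\delta_s$ is the smallest constant $\delta$ such that $(1-\delta)\|x\|^2\le\|\Psi x\|^2\le(1+\delta)\|x\|^2$ for all $x\in\mathbb{R}^p$ with $\|x\|_0\le s$, where $\|x\|_0$ is the number of nonzero components of $x$. For $\lambda>0$, $J_\lambda(x)=\frac12\|\Psi x-y\|^2+\lambda\|x\|_0$. *)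

theory Defs
  imports "HOL-Analysis.Analysis"
begin

definition supp :: "real^'p \<Rightarrow> 'p set" where
  "supp x = {i. x $ i \<noteq> 0}"

definition l0 :: "real^'p \<Rightarrow> nat" where
  "l0 x = card (supp x)"

definition J :: "real^'p^'n \<Rightarrow> real^'n \<Rightarrow> real \<Rightarrow> real^'p \<Rightarrow> real" where
  "J \<Psi> y lam x = 1/2 * (norm (\<Psi> *v x - y))\<^sup>2 + lam * real (l0 x)"

definition mutual_coherence :: "real^'p^'n \<Rightarrow> real" where
  "mutual_coherence \<Psi> = Max {\<bar>column i \<Psi> \<bullet> column j \<Psi>\<bar> |i j. i \<noteq> j}"

definition rip_bound :: "real^'p^'n \<Rightarrow> nat \<Rightarrow> real \<Rightarrow> bool" where
  "rip_bound \<Psi> s \<delta> \<longleftrightarrow> (\<forall>x. l0 x \<le> s \<longrightarrow>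
     (1 - \<delta>) * (norm x)\<^sup>2 \<le> (norm (\<Psi> *v x))\<^sup>2 \<and>
     (norm (\<Psi> *v x))\<^sup>2 \<le> (1 + \<delta>) * (norm x)\<^sup>2)"

text \<open>For \<open>s \<ge> 1\<close> the least such constant exists, see \<open>rip_const_least\<close> below.\<close>

definition rip_const :: "real^'p^'n \<Rightarrow> nat \<Rightarrow> real" where
  "rip_const \<Psi> s = (LEAST \<delta>. rip_bound \<Psi> s \<delta>)"

text \<open>The Moore-Penrose pseudoinverse, through the four Penrose conditions.\<close>

definition is_pinv :: "real^'p^'n \<Rightarrow> real^'n^'p \<Rightarrow> bool" where
  "is_pinv M X \<longleftrightarrow> M ** X ** M = M \<and> X ** M ** X = X \<and>
     transpose (M ** X) = M ** X \<and> transpose (X ** M) = X ** M"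

definition pinv :: "real^'p^'n \<Rightarrow> real^'n^'p" where
  "pinv M = (THE X. is_pinv M X)"

text \<open>
  The column set \<open>A\<close> is a value and not a type, so the submatrix of \<open>\<Psi>\<close> with columns
  in \<open>A\<close> is represented with the full column index type, the columns outside \<open>A\<close> being
  zero. Its pseudoinverse has the pseudoinverse of the genuine submatrix in the rows
  indexed by \<open>A\<close> and zeros in the other rows, see \<open>pinv_cols_on\<close> below.
\<close>

definition cols_on :: "'p set \<Rightarrow> real^'p^'n \<Rightarrow> real^'p^'n" where
  "cols_on A \<Psi> = (\<chi> i j. if j \<in> A then \<Psi> $ i $ j else 0)"

definition oracle_solution :: "real^'p^'n \<Rightarrow> 'p set \<Rightarrow> real^'n \<Rightarrow> real^'p" where
  "oracle_solution \<Psi> A y = (\<chi> i. if i \<in> A then (pinv (cols_on A \<Psi>) *v y) $ i else 0)"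


lemma is_pinv_unique:
  fixes M :: "real^'p^'n"
  assumes X: "is_pinv M X" and Y: "is_pinv M Y"
  shows "X = Y"
proof -
  have 1: "M ** X = M ** Y"
  proof -
    have "M ** X = transpose (M ** Y ** (M ** X))"
      using X Y unfolding is_pinv_def by (metis matrix_mul_assoc)
    also have "\<dots> = M ** X ** (M ** Y)"
      using X Y unfolding is_pinv_def by (metis matrix_transpose_mul)
    also have "\<dots> = M ** Y"
      using X unfolding is_pinv_def by (metis matrix_mul_assoc)
    finally show ?thesis .
  qed
  have 2: "X ** M = Y ** M"
  proof -
    have "X ** M = transpose (X ** M ** (Y ** M))"
      using X Y unfolding is_pinv_def by (metis matrix_mul_assoc)
    also have "\<dots> = Y ** M ** (X ** M)"
      using X Y unfolding is_pinv_def by (metis matrix_transpose_mul)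
    also have "\<dots> = Y ** M"
      using X unfolding is_pinv_def by (metis matrix_mul_assoc)
    finally show ?thesis .
  qed
  have "X = X ** (M ** X)" using X unfolding is_pinv_def by (metis matrix_mul_assoc)
  also have "\<dots> = Y ** M ** Y" using 1 2 by (metis matrix_mul_assoc)
  also have "\<dots> = Y" using Y unfolding is_pinv_def by blast
  finally show ?thesis .
qed

lemma pinv_eqI: "is_pinv M X \<Longrightarrow> pinv M = X"
  unfolding pinv_def by (rule the_equality) (auto intro: is_pinv_unique)

lemma symmetric_matrixI:
  fixes N :: "real^'m^'m"
  assumes "\<And>x y. (N *v x) \<bullet> y = x \<bullet> (N *v y)"
  shows "transpose N = N"
proof -
  have "transpose N *v y = N *v y" for y
  proof -
    have "x \<bullet> (transpose N *v y) = x \<bullet> (N *v y)" for x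
      by (metis assms dot_lmul_matrix inner_commute transpose_matrix_vector)
    then show ?thesis by (metis vector_eq_ldot)
  qed
  then show ?thesis by (simp add: matrix_eq)
qed

lemma is_pinv_exists:
  fixes M :: "real^'p^'n"
  shows "\<exists>X. is_pinv M X"
proof -
  note transpose_matrix_vector [simp del]
  define R where "R = range (\<lambda>z. transpose M *v z)"
  define N where "N = (\<lambda>x. transpose M *v (M *v x))"
  have adj: "(M *v a) \<bullet> b = a \<bullet> (transpose M *v b)" for a b
    by (metis dot_lmul_matrix inner_commute transpose_matrix_vector)
  have subR: "subspace R" unfolding R_def
    by (rule linear_subspace_image) (auto intro: matrix_vector_mul_linear)
  have linN: "linear N" unfolding N_def
    by (rule linear_compose[unfolded o_def, where g = "\<lambda>x. transpose M *v x"])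
      (rule matrix_vector_mul_linear)+
  have ker: "M *v x = 0" if "N x = 0" for x
  proof -
    have "(M *v x) \<bullet> (M *v x) = x \<bullet> N x" unfolding N_def by (rule adj)
    then show ?thesis using that by simp
  qed
  have orth0: "x = 0" if xR: "x \<in> R" and x0: "M *v x = 0" for x
  proof -
    obtain z where z: "x = transpose M *v z" using xR unfolding R_def by auto
    have "x \<bullet> x = (M *v x) \<bullet> z" using adj[of x z] z by simp
    then show ?thesis using x0 by simp
  qed
  have inj: "inj_on N R"
  proof (rule inj_onI)
    fix x y assume h: "x \<in> R" "y \<in> R" "N x = N y"
    have "N (x - y) = 0" using h(3) linear_diff[OF linN] by simp
    then have "M *v (x - y) = 0" by (rule ker)
    moreover have "x - y \<in> R" using h subR by (simp add: subspace_diff)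
    ultimately show "x = y" using orth0 by fastforce
  qed
  obtain g where g: "range g \<subseteq> R" "linear g" "\<forall>v\<in>R. g (N v) = v"
    using linear_exists_left_inverse_on[OF linN subR inj] by blast
  have decomp: "\<exists>r\<in>R. M *v x = M *v r" for x
  proof -
    obtain r w where rw: "r \<in> span R" "\<And>v. v \<in> span R \<Longrightarrow> orthogonal w v" "x = r + w"
      using orthogonal_subspace_decomp_exists[of R x] by blast
    have rR: "r \<in> R" using rw(1) subR by (metis span_eq_iff)
    have "(M *v w) \<bullet> z = 0" for z
      using rw(2)[of "transpose M *v z"] adj[of w z]
      by (auto simp: orthogonal_def R_def intro: span_base)
    then have "M *v w = 0" by (metis inner_eq_zero_iff)
    then show ?thesis using rw(3) rR by (auto simp: matrix_vector_right_distrib)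
  qed
  have decompT: "\<exists>r\<in>R. transpose M *v y = N r" for y
  proof -
    have s: "subspace (range (\<lambda>x. M *v x))"
      by (rule linear_subspace_image) (auto intro: matrix_vector_mul_linear)
    obtain r w where rw: "r \<in> span (range (\<lambda>x. M *v x))"
      "\<And>v. v \<in> span (range (\<lambda>x. M *v x)) \<Longrightarrow> orthogonal w v" "y = r + w"
      using orthogonal_subspace_decomp_exists[of "range (\<lambda>x. M *v x)" y] by blast
    obtain x where x: "r = M *v x" using rw(1) s by (metis span_eq_iff imageE)
    obtain q where q: "q \<in> R" "M *v x = M *v q" using decomp by blast
    have "z \<bullet> (transpose M *v w) = 0" for z
      using rw(2)[of "M *v z"] adj[of z w]
      by (auto simp: orthogonal_def inner_commute intro: span_base)
    then have "transpose M *v w = 0" by (metis inner_eq_zero_iff)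
    then show ?thesis using rw(3) x q by (auto simp: matrix_vector_right_distrib N_def)
  qed
  define X where "X = matrix (\<lambda>y. g (transpose M *v y))"
  have X: "X *v y = g (transpose M *v y)" for y
    unfolding X_def
    using fun_cong[OF matrix_vector_mul(2)[OF
        linear_compose[OF matrix_vector_mul_linear g(2), of "transpose M"]], of y]
    by (simp only: o_def)
  have XM: "X *v (M *v r) = r" if "r \<in> R" for r
    using g(3) that by (simp add: X N_def)
  have XR: "X *v y \<in> R" for y using g(1) by (auto simp: X)
  have XMr: "\<exists>r\<in>R. X *v (M *v x) = r \<and> M *v x = M *v r" for x
    using decomp[of x] XM by metis
  have a: "M ** X ** M = M"
    unfolding matrix_eq matrix_vector_mul_assoc[symmetric] using XMr by metis
  have b: "X ** M ** X = X"
    unfolding matrix_eq matrix_vector_mul_assoc[symmetric] using XM XR by metis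
  have c: "transpose (M ** X) = M ** X"
  proof (rule symmetric_matrixI, unfold matrix_vector_mul_assoc[symmetric])
    fix x y
    obtain r q where r: "r \<in> R" "transpose M *v x = N r" and q: "q \<in> R" "transpose M *v y = N q"
      using decompT by meson
    have xr: "X *v x = r" and xq: "X *v y = q" using g(3) r q by (auto simp: X)
    have "(M *v r) \<bullet> y = r \<bullet> N q" using adj q by simp
    also have "\<dots> = N r \<bullet> q" unfolding N_def by (metis adj inner_commute)
    also have "\<dots> = x \<bullet> (M *v q)" using adj r(2) by (metis inner_commute)
    finally show "(M *v (X *v x)) \<bullet> y = x \<bullet> (M *v (X *v y))" by (simp add: xr xq)
  qed
  have d: "transpose (X ** M) = X ** M"
  proof (rule symmetric_matrixI, unfold matrix_vector_mul_assoc[symmetric])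
    fix x y
    have key: "(a - X *v (M *v a)) \<bullet> r = 0" if rR: "r \<in> R" for a r
    proof -
      obtain z where z: "r = transpose M *v z" using rR unfolding R_def by auto
      have "M *v (a - X *v (M *v a)) = 0"
        using XMr[of a] by (auto simp: matrix_vector_mult_diff_distrib)
      then show ?thesis using adj[of "a - X *v (M *v a)" z] z by simp
    qed
    have "X *v (M *v y) \<in> R" "X *v (M *v x) \<in> R" by (rule XR)+
    then show "(X *v (M *v x)) \<bullet> y = x \<bullet> (X *v (M *v y))"
      using key[of "X *v (M *v y)" x] key[of "X *v (M *v x)" y]
      unfolding inner_diff_left by (metis eq_iff_diff_eq_0 inner_commute)
  qed
  show ?thesis using a b c d unfolding is_pinv_def by blast
qed

lemma is_pinv_pinv: "is_pinv M (pinv M)"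
  using is_pinv_exists pinv_eqI by metis

lemma pinv_eq_gram:
  fixes M :: "real^'p^'n"
  assumes "invertible (transpose M ** M)"
  shows "pinv M = matrix_inv (transpose M ** M) ** transpose M"
proof -
  define G where "G = transpose M ** M"
  define H where "H = matrix_inv G"
  have GH: "G ** H = mat 1" "H ** G = mat 1"
    using someI_ex[of "\<lambda>A'. G ** A' = mat 1 \<and> A' ** G = mat 1"] assms
    unfolding H_def matrix_inv_def invertible_def G_def by auto
  have GT: "transpose G = G" by (simp add: G_def matrix_transpose_mul)
  have HT: "transpose H = H"
    by (metis GH GT matrix_mul_assoc matrix_mul_lid matrix_mul_rid matrix_transpose_mul transpose_mat)
  have XM: "H ** transpose M ** M = mat 1"
    using GH(2) unfolding G_def by (simp add: matrix_mul_assoc)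
  have "is_pinv M (H ** transpose M)"
    unfolding is_pinv_def
  proof (intro conjI)
    show "M ** (H ** transpose M) ** M = M"
      using XM by (metis matrix_mul_assoc matrix_mul_rid)
    show "H ** transpose M ** M ** (H ** transpose M) = H ** transpose M"
      using XM by simp
    show "transpose (M ** (H ** transpose M)) = M ** (H ** transpose M)"
      by (simp add: matrix_transpose_mul HT matrix_mul_assoc)
    show "transpose (H ** transpose M ** M) = H ** transpose M ** M"
      by (simp add: XM transpose_mat)
  qed
  then show ?thesis using pinv_eqI G_def H_def by metis
qed

text \<open>Here \<open>e\<close> enumerates \<open>A\<close>, and \<open>\<chi> i k. \<Psi> $ i $ e k\<close> is the genuine submatrix.\<close>

lemma pinv_cols_on:
  fixes \<Psi> :: "real^'p^'n" and e :: "'t::finite \<Rightarrow> 'p"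
  assumes e: "inj e" "range e = A"
  shows "pinv (cols_on A \<Psi>) $ e k = pinv (\<chi> i k. \<Psi> $ i $ e k) $ k"
    and "j \<notin> A \<Longrightarrow> pinv (cols_on A \<Psi>) $ j = 0"
proof -
  define S :: "real^'t^'n" where "S = (\<chi> i k. \<Psi> $ i $ e k)"
  define E :: "real^'t^'p" where "E = (\<chi> j k. if j = e k then 1 else 0)"
  define X where "X = pinv S"
  have EE: "transpose E ** E = mat 1"
    using e(1) by (simp add: E_def transpose_def matrix_matrix_mult_def mat_def vec_eq_iff
        inj_eq if_distrib[of "\<lambda>x. x * _"] cong: if_cong)
  have M: "cols_on A \<Psi> = S ** transpose E"
  proof -
    have "(\<Sum>k\<in>UNIV. \<Psi> $ i $ e k * (if j = e k then 1 else 0)) = (if j \<in> A then \<Psi> $ i $ j else 0)"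
      for i j
    proof (cases "j \<in> A")
      case True
      then obtain k0 where k0: "j = e k0" using e(2) by auto
      have "(\<Sum>k\<in>UNIV. \<Psi> $ i $ e k * (if j = e k then 1 else 0))
          = (\<Sum>k\<in>UNIV. if k0 = k then \<Psi> $ i $ e k else 0)"
        by (rule sum.cong) (use e(1) k0 in \<open>auto simp: inj_eq\<close>)
      then show ?thesis using True k0 by simp
    next
      case False
      then have "j \<noteq> e k" for k using e(2) by auto
      then show ?thesis using False by simp
    qed
    then show ?thesis
      by (simp add: cols_on_def S_def E_def transpose_def matrix_matrix_mult_def vec_eq_iff)
  qed
  have X: "S ** X ** S = S" "X ** S ** X = X" "transpose (S ** X) = S ** X"
    "transpose (X ** S) = X ** S"
    using is_pinv_pinv[of S] by (auto simp: is_pinv_def X_def)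
  have ST: "S ** transpose E ** (E ** X) = S ** X"
    by (metis EE matrix_mul_assoc matrix_mul_rid)
  have "is_pinv (S ** transpose E) (E ** X)"
    unfolding is_pinv_def
  proof (intro conjI)
    show "S ** transpose E ** (E ** X) ** (S ** transpose E) = S ** transpose E"
      using ST X(1) by (metis matrix_mul_assoc)
    show "E ** X ** (S ** transpose E) ** (E ** X) = E ** X"
      using ST X(2) by (metis matrix_mul_assoc)
    show "transpose (S ** transpose E ** (E ** X)) = S ** transpose E ** (E ** X)"
      using ST X(3) by simp
    have "E ** X ** (S ** transpose E) = E ** (X ** S) ** transpose E"
      by (simp add: matrix_mul_assoc)
    then show "transpose (E ** X ** (S ** transpose E)) = E ** X ** (S ** transpose E)"
      using X(4) by (metis matrix_mul_assoc matrix_transpose_mul transpose_transpose)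
  qed
  then have P: "pinv (cols_on A \<Psi>) = E ** X" using M pinv_eqI by metis
  have "(E ** X) $ e k = X $ k"
    using e(1) by (simp add: E_def matrix_matrix_mult_def vec_eq_iff inj_eq
        if_distrib[of "\<lambda>x. x * _"] cong: if_cong)
  then show "pinv (cols_on A \<Psi>) $ e k = pinv (\<chi> i k. \<Psi> $ i $ e k) $ k"
    using P by (simp add: X_def S_def)
  show "pinv (cols_on A \<Psi>) $ j = 0" if "j \<notin> A"
  proof -
    have "j \<noteq> e k" for k using that e(2) by auto
    then show ?thesis using P by (simp add: E_def matrix_matrix_mult_def vec_eq_iff)
  qed
qed

lemma rip_const_least:
  fixes \<Psi> :: "real^'p^'n"
  assumes "s \<ge> 1"
  shows "rip_bound \<Psi> s (rip_const \<Psi> s)"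
    and "rip_bound \<Psi> s \<delta> \<Longrightarrow> rip_const \<Psi> s \<le> \<delta>"
proof -
  define D where "D = {\<delta>. rip_bound \<Psi> s \<delta>}"
  obtain a :: 'p where True by simp
  have l: "l0 (axis a (1::real)) \<le> s"
    using assms by (simp add: l0_def supp_def axis_def)
  have nn: "0 \<le> \<delta>" if "\<delta> \<in> D" for \<delta>
  proof -
    have "(1 - \<delta>) * (norm (axis a (1::real)))\<^sup>2 \<le> (1 + \<delta>) * (norm (axis a (1::real)))\<^sup>2"
      using that l unfolding D_def rip_bound_def by fastforce
    then show ?thesis by simp
  qed
  obtain K where K: "\<And>x. norm (\<Psi> *v x) \<le> norm x * K"
    using bounded_linear.bounded[OF matrix_vector_mul_bounded_linear] by blast
  have "1 + K\<^sup>2 \<in> D"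
  proof -
    have "(norm (\<Psi> *v x))\<^sup>2 \<le> K\<^sup>2 * (norm x)\<^sup>2" for x
      using power_mono[OF K[of x] norm_ge_zero, of 2] by (simp add: power_mult_distrib mult.commute)
    moreover have "K\<^sup>2 * (norm x)\<^sup>2 \<le> (1 + (1 + K\<^sup>2)) * (norm x)\<^sup>2" for x :: "real^'p"
      by (rule mult_right_mono) auto
    moreover have "(1 - (1 + K\<^sup>2)) * (norm x)\<^sup>2 \<le> (norm (\<Psi> *v x))\<^sup>2" for x
    proof -
      have "(1 - (1 + K\<^sup>2)) * (norm x)\<^sup>2 \<le> 0" by (simp add: mult_nonpos_nonneg)
      then show ?thesis by (rule order_trans) simp
    qed
    ultimately show ?thesis
      unfolding D_def rip_bound_def mem_Collect_eq by (blast intro: order_trans)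
  qed
  moreover have "closed D"
    unfolding D_def rip_bound_def
    by (intro closed_Collect_all closed_Collect_imp closed_Collect_conj closed_Collect_le
        continuous_intros) auto
  ultimately have D: "Inf D \<in> D" using nn by (intro closed_contains_Inf bdd_belowI) auto
  have inf: "Inf D \<le> \<delta>" if "\<delta> \<in> D" for \<delta>
    using that nn by (intro cInf_lower bdd_belowI) auto
  have eq: "rip_const \<Psi> s = Inf D"
    unfolding rip_const_def using D inf by (intro Least_equality) (auto simp: D_def)
  show "rip_bound \<Psi> s (rip_const \<Psi> s)" using D eq by (simp add: D_def)
  show "rip_const \<Psi> s \<le> \<delta>" if "rip_bound \<Psi> s \<delta>" using inf[of \<delta>] that eq by (simp add: D_def)
qed

end

theory Submission
  imports Defs
begin

text \<open>
  The oracle energy is at most \<open>\<epsilon>\<^sup>2 / 2 + \<lambda> T\<close>, so a competitor \<open>x\<close> with more than \<open>T\<close> nonzero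
  entries loses because of \<open>\<lambda> > \<epsilon>\<^sup>2 / 2\<close>, and one with the true support loses because the oracle is
  the least squares solution there. Otherwise \<open>x\<close> misses \<open>k \<ge> 1\<close> true indices and has \<open>l \<le> k\<close>
  spurious ones; with \<open>v = \<Psi> (x\<^sup>* - x)\<close> its energy exceeds that of the oracle by at least
  \<open>\<parallel>v\<parallel>\<^sup>2 / 2 - \<epsilon> \<parallel>v\<parallel> - \<lambda> (k - l)\<close>, where \<open>\<parallel>v\<parallel>\<^sup>2 \<ge> c k m\<^sup>2\<close> by near isometry. Under the isometry
  assumption \<open>c = 1 - \<delta>\<close>. Under the coherence assumption \<open>c = 1 - (s - 1) \<nu>\<close>, where \<open>s\<close> bounds the
  size \<open>T + l\<close> of the support of \<open>x\<^sup>* - x\<close>: if \<open>l < k\<close> then \<open>s = 2 T - 1\<close>, which matches the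
  threshold \<open>\<xi>\<close>, and if \<open>l = k\<close> the penalties cancel and \<open>s = 2 T\<close> suffices.
\<close>

section \<open>Products and norms as sums over a support\<close>

lemma matrix_vector_mult_eq_sum_supp:
  fixes \<Psi> :: "real^'p^'n"
  assumes "supp x \<subseteq> S"
  shows "\<Psi> *v x = (\<Sum>i\<in>S. (x $ i) *\<^sub>R column i \<Psi>)"
proof -
  have "\<Psi> *v x = (\<Sum>i\<in>UNIV. (x $ i) *\<^sub>R column i \<Psi>)"
    by (simp add: matrix_mult_sum scalar_mult_eq_scaleR)
  also have "\<dots> = (\<Sum>i\<in>S. (x $ i) *\<^sub>R column i \<Psi>)"
    using assms by (intro sum.mono_neutral_right) (auto simp: supp_def)
  finally show ?thesis .
qed

lemma norm_eq_sum_supp: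
  assumes "supp x \<subseteq> S"
  shows "(norm x)\<^sup>2 = (\<Sum>i\<in>S. (x $ i)\<^sup>2)"
proof -
  have "(norm x)\<^sup>2 = (\<Sum>i\<in>UNIV. (x $ i)\<^sup>2)"
    by (simp add: norm_vec_def L2_set_def sum_nonneg)
  also have "\<dots> = (\<Sum>i\<in>S. (x $ i)\<^sup>2)"
    using assms by (intro sum.mono_neutral_right) (auto simp: supp_def)
  finally show ?thesis .
qed

section \<open>Near isometry from mutual coherence\<close>

lemma abs_inner_le_mutual_coherence:
  fixes \<Psi> :: "real^'p^'n"
  assumes "i \<noteq> j"
  shows "\<bar>column i \<Psi> \<bullet> column j \<Psi>\<bar> \<le> mutual_coherence \<Psi>"
proof -
  have "finite {\<bar>column i \<Psi> \<bullet> column j \<Psi>\<bar> |i j. i \<noteq> j}"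
    by (rule finite_subset[of _ "range (\<lambda>(i, j). \<bar>column i \<Psi> \<bullet> column j \<Psi>\<bar>)"]) auto
  then show ?thesis
    unfolding mutual_coherence_def using assms by (intro Max_ge) auto
qed

text \<open>With two distinct columns the maximum runs over a nonempty set of absolute
  values.\<close>

lemma mutual_coherence_nonneg:
  fixes \<Psi> :: "real^'p^'n"
  assumes "CARD('p) > 1"
  shows "0 \<le> mutual_coherence \<Psi>"
proof -
  obtain i j :: 'p where "i \<noteq> j"
    using assms by (metis UNIV_I card_le_Suc0_iff_eq finite not_less One_nat_def)
  then show ?thesis
    using abs_inner_le_mutual_coherence[of i j \<Psi>] by simp
qed

text \<open>The Gram matrix has unit diagonal and off-diagonal entries of modulus at most \<nu>, so
  the quadratic form loses at most \<nu> times the off-diagonal part of the squared l1 norm of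
  \<open>z\<close>. Cauchy-Schwarz on the support bounds that squared l1 norm by \<open>s\<close>
  times the squared Euclidean norm. A real \<open>s\<close> allows the value 2T - 1 without
  truncated subtraction.\<close>

lemma coherence_lower_bound:
  fixes \<Psi> :: "real^'p^'n"
  assumes nrm: "\<And>i. norm (column i \<Psi>) = 1"
    and \<nu>: "\<nu> = mutual_coherence \<Psi>" "0 \<le> \<nu>"
    and s: "real (l0 z) \<le> s"
  shows "(1 - (s - 1) * \<nu>) * (norm z)\<^sup>2 \<le> (norm (\<Psi> *v z))\<^sup>2"
proof -
  define S where "S = supp z"
  have nz: "(norm z)\<^sup>2 = (\<Sum>i\<in>S. (z $ i)\<^sup>2)"
    by (rule norm_eq_sum_supp) (simp add: S_def)
  have gram: "(norm (\<Psi> *v z))\<^sup>2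
      = (\<Sum>i\<in>S. \<Sum>j\<in>S. z $ i * z $ j * (column i \<Psi> \<bullet> column j \<Psi>))"
    unfolding power2_norm_eq_inner matrix_vector_mult_eq_sum_supp[of z S \<Psi>, unfolded S_def, OF order_refl]
    by (simp add: inner_sum_left inner_sum_right S_def mult.assoc sum_distrib_left)
      (intro sum.cong refl, simp add: inner_commute)
  \<comment> \<open>The extra \<nu> on the diagonal offsets the subtracted term at i = j. The
    subtraction then runs over all pairs, and its double sum factors as a square.\<close>
  have entry: "(if i = j then (1 + \<nu>) * (z $ i)\<^sup>2 else 0) - \<nu> * (\<bar>z $ i\<bar> * \<bar>z $ j\<bar>)
      \<le> z $ i * z $ j * (column i \<Psi> \<bullet> column j \<Psi>)" for i j
  proof (cases "i = j")
    case True
    have "column i \<Psi> \<bullet> column i \<Psi> = 1"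
      using nrm[of i] by (simp add: norm_eq_sqrt_inner)
    then show ?thesis
      using True by (simp add: power2_eq_square algebra_simps)
  next
    case False
    have "\<bar>z $ i * z $ j * (column i \<Psi> \<bullet> column j \<Psi>)\<bar> \<le> \<bar>z $ i\<bar> * \<bar>z $ j\<bar> * \<nu>"
      using abs_inner_le_mutual_coherence[OF False, of \<Psi>] \<nu>(1)
      by (simp add: abs_mult mult_left_mono)
    then show ?thesis
      using False by (simp add: abs_le_iff mult.commute)
  qed
  have cs: "(\<Sum>i\<in>S. \<bar>z $ i\<bar>)\<^sup>2 \<le> s * (norm z)\<^sup>2"
  proof -
    have "(\<Sum>i\<in>S. \<bar>z $ i\<bar>)\<^sup>2 \<le> (\<Sum>i\<in>S. \<bar>z $ i\<bar>\<^sup>2) * real (card S)"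
      by (rule sum_squared_le_sum_of_squares)
    also have "\<dots> \<le> s * (norm z)\<^sup>2"
      using s by (simp add: nz l0_def S_def mult.commute mult_right_mono sum_nonneg)
    finally show ?thesis .
  qed
  have "(1 - (s - 1) * \<nu>) * (norm z)\<^sup>2 = (1 + \<nu>) * (norm z)\<^sup>2 - \<nu> * (s * (norm z)\<^sup>2)"
    by (simp add: algebra_simps)
  also have "\<dots> \<le> (1 + \<nu>) * (norm z)\<^sup>2 - \<nu> * (\<Sum>i\<in>S. \<bar>z $ i\<bar>)\<^sup>2"
    using cs \<nu>(2) by (simp add: mult_left_mono)
  also have "\<dots> = (\<Sum>i\<in>S. \<Sum>j\<in>S.
      (if i = j then (1 + \<nu>) * (z $ i)\<^sup>2 else 0) - \<nu> * (\<bar>z $ i\<bar> * \<bar>z $ j\<bar>))"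
    by (simp add: sum_subtractf nz sum_distrib_left[symmetric] power2_eq_square[of "sum _ _"]
        sum_product)
  also have "\<dots> \<le> (norm (\<Psi> *v z))\<^sup>2"
    unfolding gram by (intro sum_mono entry)
  finally show ?thesis .
qed

section \<open>The oracle as least squares solution and as minimizer\<close>

lemma supp_oracle_solution: "supp (oracle_solution \<Psi> A y) \<subseteq> A"
  by (auto simp: supp_def oracle_solution_def)

text \<open>The zero columns hide the entries of \<open>w\<close> outside \<open>A\<close>, so the
  truncated oracle may be exchanged for the full vector
  \<open>pinv (cols_on A \<Psi>) *v y\<close>.\<close>

lemma matrix_vector_mult_cols_on:
  fixes \<Psi> :: "real^'p^'n"
  assumes "\<And>i. i \<in> A \<Longrightarrow> x $ i = w $ i" and "supp x \<subseteq> A"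
  shows "\<Psi> *v x = cols_on A \<Psi> *v w"
proof -
  have "(\<Sum>j\<in>UNIV. \<Psi> $ i $ j * x $ j)
      = (\<Sum>j\<in>UNIV. (if j \<in> A then \<Psi> $ i $ j else 0) * w $ j)" for i
    using assms by (intro sum.cong) (auto simp: supp_def)
  then show ?thesis
    by (simp add: vec_eq_iff matrix_vector_mult_def cols_on_def)
qed

text \<open>These are the normal equations. Transposing \<open>M ** X ** M = M\<close> and using the
  symmetry of \<open>M ** X\<close> yields \<open>transpose M ** (M ** X) = transpose M\<close>,
  hence \<open>transpose M\<close> annihilates the residual.\<close>

lemma oracle_residual_orthogonal:
  fixes \<Psi> :: "real^'p^'n"
  assumes "supp x \<subseteq> A"
  shows "(\<Psi> *v x) \<bullet> (\<Psi> *v oracle_solution \<Psi> A y - y) = 0"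
proof -
  define M where "M = cols_on A \<Psi>"
  define X where "X = pinv M"
  have X: "M ** X ** M = M" "transpose (M ** X) = M ** X"
    using is_pinv_pinv[of M] by (auto simp: is_pinv_def X_def)
  have MX: "transpose M ** (M ** X) = transpose M"
    using X by (metis matrix_transpose_mul)
  have xo: "\<Psi> *v oracle_solution \<Psi> A y = M *v (X *v y)"
    unfolding M_def X_def
    by (rule matrix_vector_mult_cols_on) (auto simp: oracle_solution_def supp_def)
  have x: "\<Psi> *v x = M *v x"
    unfolding M_def by (rule matrix_vector_mult_cols_on) (use assms in auto)
  have "transpose M *v (M *v (X *v y) - y) = 0"
    using MX by (simp add: matrix_vector_mult_diff_distrib matrix_vector_mul_assoc
        matrix_mul_assoc del: transpose_matrix_vector)
  moreover have "(M *v x) \<bullet> u = x \<bullet> (transpose M *v u)" for u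
    by (metis dot_lmul_matrix inner_commute transpose_matrix_vector)
  ultimately show ?thesis
    unfolding x xo by simp
qed

lemma oracle_pythagoras:
  fixes \<Psi> :: "real^'p^'n"
  assumes "supp x \<subseteq> A"
  shows "(norm (\<Psi> *v x - y))\<^sup>2 = (norm (\<Psi> *v oracle_solution \<Psi> A y - y))\<^sup>2
    + (norm (\<Psi> *v (x - oracle_solution \<Psi> A y)))\<^sup>2"
proof -
  let ?o = "oracle_solution \<Psi> A y"
  have "supp (x - ?o) \<subseteq> A"
    using assms supp_oracle_solution[of \<Psi> A y] by (fastforce simp: supp_def)
  then have "orthogonal (\<Psi> *v ?o - y) (\<Psi> *v (x - ?o))"
    using oracle_residual_orthogonal by (simp add: orthogonal_def inner_commute)
  moreover have "\<Psi> *v x - y = (\<Psi> *v ?o - y) + \<Psi> *v (x - ?o)"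
    by (simp add: matrix_vector_mult_diff_distrib)
  ultimately show ?thesis
    by (metis norm_add_Pythagorean)
qed

text \<open>The common frame for both sparsity conditions: \<open>inj\<close> makes the least
  squares solution on the true support unique, and \<open>gap\<close> handles the competitors that
  miss a true index.\<close>

lemma oracle_unique_minimizer:
  fixes \<Psi> :: "real^'p^'n"
  assumes y: "y = \<Psi> *v xs + \<eta>" and noise: "norm \<eta> \<le> \<epsilon>" and lam: "\<epsilon>\<^sup>2 / 2 < lam"
    and inj: "\<And>z. supp z \<subseteq> supp xs \<Longrightarrow> \<Psi> *v z = 0 \<Longrightarrow> z = 0"
    and gap: "\<And>x. l0 x \<le> l0 xs \<Longrightarrow> \<not> supp xs \<subseteq> supp x \<Longrightarrow>
      lam * (real (l0 xs) - real (l0 x))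
        < (norm (\<Psi> *v (xs - x)))\<^sup>2 / 2 - \<epsilon> * norm (\<Psi> *v (xs - x))"
  shows "{x. is_arg_min (J \<Psi> y lam) (\<lambda>_. True) x} = {oracle_solution \<Psi> (supp xs) y}"
proof -
  define xo where "xo = oracle_solution \<Psi> (supp xs) y"
  have pyth: "(norm (\<Psi> *v x - y))\<^sup>2 = (norm (\<Psi> *v xo - y))\<^sup>2 + (norm (\<Psi> *v (x - xo)))\<^sup>2"
    if "supp x \<subseteq> supp xs" for x
    unfolding xo_def using that by (rule oracle_pythagoras)
  have suppo: "supp xo \<subseteq> supp xs"
    unfolding xo_def by (rule supp_oracle_solution)
  have lam0: "lam > 0"
    using lam by (smt (verit) zero_le_power2 divide_nonneg_pos)
  have "real (l0 xo) \<le> real (l0 xs)"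
    unfolding l0_def using suppo by (simp add: card_mono)
  then have pen: "lam * real (l0 xo) \<le> lam * real (l0 xs)"
    using lam0 by simp
  \<comment> \<open>The true signal is itself a candidate on its support, with residual of norm
    \<open>norm \<eta>\<close>.\<close>
  have fit: "(norm (\<Psi> *v xo - y))\<^sup>2 \<le> (norm \<eta>)\<^sup>2"
    using pyth[of xs] y by simp
  have Jo: "J \<Psi> y lam xo \<le> (norm \<eta>)\<^sup>2 / 2 + lam * real (l0 xs)"
    unfolding J_def using fit pen by linarith
  have less: "J \<Psi> y lam xo < J \<Psi> y lam x" if ne: "x \<noteq> xo" for x
  proof -
    consider "l0 xs < l0 x" | "l0 x \<le> l0 xs" "supp xs \<subseteq> supp x"
      | "l0 x \<le> l0 xs" "\<not> supp xs \<subseteq> supp x"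
      by linarith
    then show ?thesis
    proof cases
      case 1
      then have "real (l0 xs) + 1 \<le> real (l0 x)" by simp
      then have "lam * (real (l0 xs) + 1) \<le> lam * real (l0 x)"
        using lam0 by (intro mult_left_mono) auto
      moreover have "(norm \<eta>)\<^sup>2 \<le> \<epsilon>\<^sup>2"
        using noise by (simp add: power_mono)
      ultimately show ?thesis
        using Jo lam zero_le_power2[of "norm (\<Psi> *v x - y)"]
        unfolding J_def distrib_left by linarith
    next
      case 2
      then have s: "supp x = supp xs"
        unfolding l0_def by (metis card_seteq finite)
      then have "supp (x - xo) \<subseteq> supp xs"
        using suppo by (fastforce simp: supp_def)
      then have "\<Psi> *v (x - xo) \<noteq> 0"
        using inj[of "x - xo"] ne by auto
      then have "(norm (\<Psi> *v xo - y))\<^sup>2 < (norm (\<Psi> *v x - y))\<^sup>2"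
        using pyth[of x] s by simp
      then show ?thesis
        using pen s unfolding J_def by (simp add: l0_def)
    next
      case 3
      define v where "v = \<Psi> *v (xs - x)"
      have "\<Psi> *v x - y = - (v + \<eta>)"
        by (simp add: v_def y matrix_vector_mult_diff_distrib)
      then have "(norm (\<Psi> *v x - y))\<^sup>2 = (norm (v + \<eta>))\<^sup>2"
        by (metis norm_minus_cancel)
      also have "\<dots> = (norm v)\<^sup>2 + 2 * (v \<bullet> \<eta>) + (norm \<eta>)\<^sup>2"
        by (simp add: power2_norm_eq_inner inner_add inner_commute)
      \<comment> \<open>Only the cross term is estimated. The square of \<open>norm \<eta>\<close>
        is kept exactly, to cancel against the same term in \<open>Jo\<close>.\<close>
      also have "\<dots> \<ge> (norm v)\<^sup>2 - 2 * (\<epsilon> * norm v) + (norm \<eta>)\<^sup>2"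
      proof -
        have "\<bar>v \<bullet> \<eta>\<bar> \<le> norm v * norm \<eta>" by (rule Cauchy_Schwarz_ineq2)
        also have "\<dots> \<le> norm v * \<epsilon>" using noise by (simp add: mult_left_mono)
        finally show ?thesis by (simp add: mult.commute)
      qed
      finally show ?thesis
        using gap[OF 3] Jo unfolding J_def v_def[symmetric] by (simp add: algebra_simps)
    qed
  qed
  have "\<not> J \<Psi> y lam x < J \<Psi> y lam xo" for x
    using less[of x] by (cases "x = xo") auto
  then show ?thesis
    unfolding xo_def[symmetric] is_arg_min_def using less by blast
qed

section \<open>Lower bounds for the energy gap\<close>

lemma norm_diff_ge_card_missed:
  fixes xs x :: "real^'p"
  assumes "\<And>i. i \<in> supp xs \<Longrightarrow> m \<le> \<bar>xs $ i\<bar>" and "0 \<le> m"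
  shows "real (card (supp xs - supp x)) * m\<^sup>2 \<le> (norm (xs - x))\<^sup>2"
proof -
  have "real (card (supp xs - supp x)) * m\<^sup>2 = (\<Sum>i\<in>supp xs - supp x. m\<^sup>2)"
    by simp
  also have "\<dots> \<le> (\<Sum>i\<in>supp xs - supp x. ((xs - x) $ i)\<^sup>2)"
  proof (rule sum_mono)
    fix i assume i: "i \<in> supp xs - supp x"
    then have "m \<le> \<bar>(xs - x) $ i\<bar>" using assms(1)[of i] by (simp add: supp_def)
    then show "m\<^sup>2 \<le> ((xs - x) $ i)\<^sup>2"
      using assms(2) by (metis power2_abs power_mono)
  qed
  also have "\<dots> \<le> (\<Sum>i\<in>UNIV. ((xs - x) $ i)\<^sup>2)"
    by (rule sum_mono2) auto
  also have "\<dots> = (norm (xs - x))\<^sup>2"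
    using norm_eq_sum_supp[of "xs - x" UNIV] by simp
  finally show ?thesis .
qed

text \<open>The function a^2 / 2 - \<epsilon> a increases for a \<ge> \<epsilon>, so it may be
  evaluated at the lower bound t = sqrt (c k) m of \<open>a\<close>, which is at least \<epsilon>
  because \<beta> \<le> sqrt c and k \<ge> 1. Replacing sqrt k by k in the noise term makes the
  result linear in k, like the penalty.\<close>

lemma noisy_energy_lower_bound:
  fixes a c k m \<beta> \<epsilon> :: real
  assumes a: "c * (k * m\<^sup>2) \<le> a\<^sup>2" "0 \<le> a"
    and k: "1 \<le> k" and m: "0 \<le> m" and \<epsilon>: "\<epsilon> \<le> \<beta> * m" and \<beta>: "0 \<le> \<beta>" "\<beta> \<le> sqrt c"
  shows "k * m\<^sup>2 * (c / 2 - \<beta> * sqrt c) \<le> a\<^sup>2 / 2 - \<epsilon> * a"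
proof -
  define t where "t = sqrt c * sqrt k * m"
  have c: "0 \<le> sqrt c" "0 \<le> c"
    using order_trans[OF \<beta>] by simp_all
  have k1: "1 \<le> sqrt k" "sqrt k \<le> k"
    using k by (auto intro!: real_le_lsqrt self_le_power)
  have t0: "0 \<le> t"
    unfolding t_def using c k m by simp
  have t2: "t\<^sup>2 = c * (k * m\<^sup>2)"
    unfolding t_def using c k by (simp add: power_mult_distrib)
  have ta: "t \<le> a"
    using a t2 by (metis power2_le_imp_le)
  have "\<beta> * m \<le> sqrt c * 1 * m"
    using \<beta>(2) m by (simp add: mult_right_mono)
  also have "\<dots> \<le> t"
    unfolding t_def using c k1 m by (intro mult_right_mono mult_left_mono) auto
  finally have et: "\<epsilon> \<le> t"
    using \<epsilon> by simp
  have "\<epsilon> * t \<le> \<beta> * m * t"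
    using \<epsilon> t0 by (rule mult_right_mono)
  also have "\<dots> = \<beta> * sqrt c * m\<^sup>2 * sqrt k"
    by (simp add: t_def power2_eq_square)
  also have "\<dots> \<le> \<beta> * sqrt c * m\<^sup>2 * k"
    using k1 c \<beta> by (intro mult_left_mono) auto
  finally have "k * m\<^sup>2 * (c / 2 - \<beta> * sqrt c) \<le> t\<^sup>2 / 2 - \<epsilon> * t"
    unfolding t2 by (simp add: algebra_simps)
  also have "\<dots> \<le> a\<^sup>2 / 2 - \<epsilon> * a"
  proof -
    \<comment> \<open>This product is the difference of the two sides, and both factors are
      nonnegative since a \<ge> t \<ge> \<epsilon>.\<close>
    have "0 \<le> (a - t) * ((a + t) / 2 - \<epsilon>)"
      using ta et by (intro mult_nonneg_nonneg) auto
    then show ?thesis by (simp add: power2_eq_square field_simps)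
  qed
  finally show ?thesis .
qed

section \<open>Support counting and the coherence condition\<close>

lemma l0_diff_le: "l0 (xs - x) \<le> l0 xs + card (supp x - supp xs)"
proof -
  have "l0 (xs - x) \<le> card (supp xs \<union> (supp x - supp xs))"
    unfolding l0_def by (rule card_mono) (auto simp: supp_def)
  also have "\<dots> \<le> l0 xs + card (supp x - supp xs)"
    unfolding l0_def by (rule card_Un_le)
  finally show ?thesis .
qed

lemma l0_exchange:
  "l0 xs + card (supp x - supp xs) = l0 x + card (supp xs - supp x)"
proof -
  have "card (supp xs) = card (supp xs \<inter> supp x) + card (supp xs - supp x)"
    "card (supp x) = card (supp x \<inter> supp xs) + card (supp x - supp xs)"
    by (simp_all add: card_Int_Diff)
  then show ?thesis
    unfolding l0_def by (simp add: Int_commute)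
qed

text \<open>For l = k the penalties cancel and a positive energy bound suffices, which the strict
  bound on \<nu> provides. For l < k the smaller support of \<open>xs - x\<close> gives a constant c
  for which the energy bound exceeds \<open>lam * k\<close>.\<close>

lemma oracle_unique_minimizer_coherence:
  fixes \<Psi> :: "real^'p^'n" and \<nu> :: real
  defines "\<nu> \<equiv> mutual_coherence \<Psi>"
  assumes card: "CARD('p) > 1" and nrm: "\<And>i. norm (column i \<Psi>) = 1"
    and y: "y = \<Psi> *v xs + \<eta>" and noise: "norm \<eta> \<le> \<epsilon>"
    and T: "T = l0 xs" "1 \<le> T"
    and m: "0 < m" "\<And>i. i \<in> supp xs \<Longrightarrow> m \<le> \<bar>xs $ i\<bar>"
    and \<beta>: "0 \<le> \<beta>" "\<beta> < 1/2" "\<epsilon> \<le> \<beta> * m"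
    and coh: "\<nu> < (1 - 2 * \<beta>) / (3 * real T - 1)"
    and lam: "\<epsilon>\<^sup>2 / 2 < lam"
      "lam < (1 - 2 * (real T - 1) * \<nu> - 2 * \<beta> - \<beta>\<^sup>2) / (2 * real T) * m\<^sup>2"
  shows "{x. is_arg_min (J \<Psi> y lam) (\<lambda>_. True) x} = {oracle_solution \<Psi> (supp xs) y}"
proof -
  define Z where "Z = 1 - 2 * (real T - 1) * \<nu> - 2 * \<beta> - \<beta>\<^sup>2"
  have \<nu>0: "0 \<le> \<nu>"
    unfolding \<nu>_def using card by (rule mutual_coherence_nonneg)
  have T1: "1 \<le> real T" using T(2) by simp
  have lam0: "0 < lam"
    using lam(1) by (smt (verit) zero_le_power2 divide_nonneg_pos)
  \<comment> \<open>A positive \<open>lam\<close> below the threshold forces Z > 0. This allows the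
    factor 1/T to be dropped, and later gives \<beta> \<le> sqrt c.\<close>
  have "0 < Z / (2 * real T) * m\<^sup>2"
    using lam(2) lam0 unfolding Z_def by linarith
  then have Z0: "0 < Z"
    using T1 m(1) by (simp add: zero_less_mult_iff zero_less_divide_iff)
  have "Z / (2 * real T) \<le> Z / 2"
    using Z0 T1 by (intro divide_left_mono) auto
  then have lamZ: "lam < Z / 2 * m\<^sup>2"
    using lam(2) unfolding Z_def[symmetric] by (smt (verit) mult_right_mono zero_le_power2)
  have coh': "(3 * real T - 1) * \<nu> < 1 - 2 * \<beta>"
    using coh T1 by (simp add: pos_less_divide_eq mult.commute)
  have RIC: "(1 - (s - 1) * \<nu>) * (norm z)\<^sup>2 \<le> (norm (\<Psi> *v z))\<^sup>2" if "real (l0 z) \<le> s" for z s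
    using coherence_lower_bound[OF nrm \<nu>_def[THEN meta_eq_to_obj_eq] \<nu>0 that] .
  have T\<nu>: "(real T - 1) * \<nu> < 1"
  proof -
    have "(real T - 1) * \<nu> \<le> (3 * real T - 1) * \<nu>"
      using \<nu>0 T1 by (intro mult_right_mono) auto
    then show ?thesis using coh' \<beta> by linarith
  qed
  show ?thesis
  proof (rule oracle_unique_minimizer[OF y noise lam(1)])
    fix z assume z: "supp z \<subseteq> supp xs" "\<Psi> *v z = 0"
    have "real (l0 z) \<le> real T"
      unfolding T l0_def using z(1) by (simp add: card_mono)
    then have "(1 - (real T - 1) * \<nu>) * (norm z)\<^sup>2 \<le> 0"
      using RIC[of z "real T"] z(2) by simp
    then show "z = 0"
      using T\<nu> by (simp add: mult_le_0_iff)
  next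
    fix x assume x: "l0 x \<le> l0 xs" "\<not> supp xs \<subseteq> supp x"
    define k where "k = card (supp xs - supp x)"
    define l where "l = card (supp x - supp xs)"
    have k1: "1 \<le> real k"
      using x(2) by (simp add: k_def Suc_le_eq card_gt_0_iff)
    have kT: "k \<le> T"
      unfolding k_def T l0_def by (simp add: card_mono)
    have diff: "real (l0 xs) - real (l0 x) = real k - real l"
      using l0_exchange[of xs x] by (simp add: k_def l_def)
    have lk: "l \<le> k" using diff x(1) by linarith
    have sz: "l0 (xs - x) \<le> T + l"
      using l0_diff_le[of xs x] by (simp add: T l_def)
    have energy: "real k * m\<^sup>2 * (c / 2 - \<beta> * sqrt c)
        \<le> (norm (\<Psi> *v (xs - x)))\<^sup>2 / 2 - \<epsilon> * norm (\<Psi> *v (xs - x))"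
      if s: "real T + real l \<le> s" and c: "c = 1 - (s - 1) * \<nu>" "\<beta> \<le> sqrt c" for s c
    proof (rule noisy_energy_lower_bound)
      have "0 \<le> c"
        using order_trans[OF \<beta>(1) c(2)] by simp
      then have "c * (real k * m\<^sup>2) \<le> c * (norm (xs - x))\<^sup>2"
        unfolding k_def using norm_diff_ge_card_missed[of xs m x] m by (intro mult_left_mono) auto
      also have "\<dots> \<le> (norm (\<Psi> *v (xs - x)))\<^sup>2"
        unfolding c(1) using sz s by (intro RIC) linarith
      finally show "c * (real k * m\<^sup>2) \<le> (norm (\<Psi> *v (xs - x)))\<^sup>2" .
    qed (use k1 m \<beta> c in auto)
    have km: "0 < real k * m\<^sup>2" using k1 m(1) by simp
    show "lam * (real (l0 xs) - real (l0 x))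
        < (norm (\<Psi> *v (xs - x)))\<^sup>2 / 2 - \<epsilon> * norm (\<Psi> *v (xs - x))"
    proof (cases "l = k")
      case True
      define c where "c = 1 - (2 * real T - 1) * \<nu>"
      \<comment> \<open>Since 3 (2T - 1) \<le> 2 (3T - 1), doubling \<open>coh'\<close> gives 1 + 4
        \<beta> < 3 c.\<close>
      have "3 * (1 - c) \<le> 2 * ((3 * real T - 1) * \<nu>)"
        using \<nu>0 by (simp add: c_def algebra_simps)
      then have "1 + 4 * \<beta> < 3 * c"
        using coh' by argo
      \<comment> \<open>Expanded, this says 12 \<beta>^2 < 1 + 4 \<beta>, hence 4 \<beta>^2 <
        c.\<close>
      moreover have "0 < (1 - 2 * \<beta>) * (1 + 6 * \<beta>)"
        using \<beta> by (intro mult_pos_pos) auto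
      ultimately have "(2 * \<beta>)\<^sup>2 < c"
        by (simp add: power2_eq_square algebra_simps)
      then have c: "2 * \<beta> < sqrt c"
        by (rule real_less_rsqrt)
      have cpos: "0 < sqrt c" using c \<beta>(1) by linarith
      have "0 < sqrt c * (sqrt c - 2 * \<beta>)"
        using c cpos by simp
      also have "\<dots> = 2 * (c / 2 - \<beta> * sqrt c)"
        using cpos by (simp add: algebra_simps)
      finally have "0 < real k * m\<^sup>2 * (c / 2 - \<beta> * sqrt c)"
        using km by simp
      also have "\<dots> \<le> (norm (\<Psi> *v (xs - x)))\<^sup>2 / 2 - \<epsilon> * norm (\<Psi> *v (xs - x))"
        using True kT c \<beta>(1) by (intro energy[of "2 * real T"]) (auto simp: c_def)
      finally show ?thesis
        using True diff by simp
    next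
      case False
      \<comment> \<open>From l < k \<le> T follows T + l \<le> 2T - 1, so s = 2T - 1 is admissible
        and s - 1 = 2 (T - 1).\<close>
      define c where "c = 1 - 2 * (real T - 1) * \<nu>"
      have Zc: "Z = c - 2 * \<beta> - \<beta>\<^sup>2" by (simp add: Z_def c_def)
      have c1: "sqrt c \<le> 1"
        using \<nu>0 T1 by (simp add: c_def)
      have \<beta>c: "\<beta> \<le> sqrt c"
        using Z0 \<beta>(1) Zc by (intro real_le_rsqrt) simp
      have "\<beta> * sqrt c \<le> \<beta>"
        using mult_left_mono[OF c1 \<beta>(1)] by simp
      then have "Z / 2 \<le> c / 2 - \<beta> * sqrt c"
        using Zc by (smt (verit) field_sum_of_halves zero_le_power2)
      then have "Z / 2 * m\<^sup>2 \<le> (c / 2 - \<beta> * sqrt c) * m\<^sup>2"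
        by (rule mult_right_mono) simp
      then have "lam * real k < (c / 2 - \<beta> * sqrt c) * m\<^sup>2 * real k"
        using lamZ k1 by (intro mult_strict_right_mono) auto
      moreover have "lam * (real k - real l) \<le> lam * real k"
        using lam0 by simp
      ultimately have "lam * (real k - real l) < real k * m\<^sup>2 * (c / 2 - \<beta> * sqrt c)"
        by (simp add: mult_ac)
      also have "\<dots> \<le> (norm (\<Psi> *v (xs - x)))\<^sup>2 / 2 - \<epsilon> * norm (\<Psi> *v (xs - x))"
        using False lk kT \<beta>c by (intro energy[of "2 * real T - 1"]) (auto simp: c_def algebra_simps)
      finally show ?thesis
        using diff by simp
    qed
  qed
qed

section \<open>The restricted isometry condition\<close>

lemma rip_bound_nonneg:
  fixes \<Psi> :: "real^'p^'n"
  assumes "rip_bound \<Psi> s \<delta>" "1 \<le> s"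
  shows "0 \<le> \<delta>"
proof -
  obtain a :: 'p where True by simp
  have "l0 (axis a (1::real)) \<le> s"
    using assms(2) by (simp add: l0_def supp_def axis_def)
  then have "(1 - \<delta>) * (norm (axis a (1::real)))\<^sup>2 \<le> (1 + \<delta>) * (norm (axis a (1::real)))\<^sup>2"
    using assms(1) unfolding rip_bound_def by fastforce
  then show ?thesis by simp
qed

text \<open>A competitor with at most T nonzero entries differs from \<open>xs\<close> in at most 2T
  places, so the constant c = 1 - \<delta> serves all of them at once, and the penalty difference is
  bounded by \<open>lam * k\<close>.\<close>

lemma oracle_unique_minimizer_rip:
  fixes \<Psi> :: "real^'p^'n"
  assumes rip: "rip_bound \<Psi> (2 * T) \<delta>"
    and y: "y = \<Psi> *v xs + \<eta>" and noise: "norm \<eta> \<le> \<epsilon>"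
    and T: "T = l0 xs" "1 \<le> T"
    and m: "0 < m" "\<And>i. i \<in> supp xs \<Longrightarrow> m \<le> \<bar>xs $ i\<bar>"
    and \<beta>: "0 \<le> \<beta>" "\<beta> < 1/2" "\<epsilon> \<le> \<beta> * m"
    and \<delta>: "\<delta> \<le> (1 - 2 * \<beta>) / (2 * sqrt (real T) + 1)"
    and lam: "\<epsilon>\<^sup>2 / 2 < lam"
      "lam < (1/2 * (1 - \<delta>) - \<delta>\<^sup>2 / (1 - \<delta>) - \<beta> / sqrt (1 - \<delta>) - 1/2 * \<beta>\<^sup>2) * m\<^sup>2"
  shows "{x. is_arg_min (J \<Psi> y lam) (\<lambda>_. True) x} = {oracle_solution \<Psi> (supp xs) y}"
proof -
  define c where "c = 1 - \<delta>"
  have \<delta>0: "0 \<le> \<delta>"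
    using rip_bound_nonneg[OF rip] T(2) by simp
  \<comment> \<open>The numerator is at most 1 and the denominator at least 3, so \<delta> \<le>
    1/3. Then c \<ge> 2/3 > 1/4 \<ge> \<beta>^2.\<close>
  have "(1 - 2 * \<beta>) / (2 * sqrt (real T) + 1) \<le> 1 / 3"
    using T(2) \<beta> by (intro frac_le) auto
  then have c: "2 / 3 \<le> c" "c \<le> 1"
    using \<delta> \<delta>0 unfolding c_def by linarith+
  have "\<beta>\<^sup>2 \<le> (1/2)\<^sup>2"
    using \<beta> by (intro power_mono) auto
  then have \<beta>c: "\<beta> \<le> sqrt c"
    using c(1) by (intro real_le_rsqrt) (simp add: power2_eq_square)
  have lam0: "0 < lam"
    using lam(1) by (smt (verit) zero_le_power2 divide_nonneg_pos)
  \<comment> \<open>As c \<le> 1, the noise term \<beta> / sqrt c of the threshold dominates the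
    \<beta> sqrt c of the energy bound. The other two subtracted terms only lower the
    threshold.\<close>
  have "sqrt c * sqrt c \<le> 1"
    using c by simp
  then have "sqrt c \<le> 1 / sqrt c"
    using c by (simp add: pos_le_divide_eq)
  then have "\<beta> * sqrt c \<le> \<beta> / sqrt c"
    using mult_left_mono[of "sqrt c" "1 / sqrt c" \<beta>] \<beta>(1) by simp
  moreover have "0 \<le> \<delta>\<^sup>2 / c" "0 \<le> \<beta>\<^sup>2"
    using c by auto
  ultimately have "1/2 * c - \<delta>\<^sup>2 / c - \<beta> / sqrt c - 1/2 * \<beta>\<^sup>2 \<le> c / 2 - \<beta> * sqrt c"
    by linarith
  then have lamc: "lam < (c / 2 - \<beta> * sqrt c) * m\<^sup>2"
    using lam(2) unfolding c_def[symmetric] by (smt (verit) mult_right_mono zero_le_power2)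
  have low: "c * (norm z)\<^sup>2 \<le> (norm (\<Psi> *v z))\<^sup>2" if "l0 z \<le> 2 * T" for z
    using rip that by (simp add: rip_bound_def c_def)
  show ?thesis
  proof (rule oracle_unique_minimizer[OF y noise lam(1)])
    fix z assume z: "supp z \<subseteq> supp xs" "\<Psi> *v z = 0"
    have "l0 z \<le> T"
      unfolding T l0_def using z(1) by (simp add: card_mono)
    then have "c * (norm z)\<^sup>2 \<le> 0"
      using low[of z] z(2) by simp
    then show "z = 0"
      using c(1) by (simp add: mult_le_0_iff)
  next
    fix x assume x: "l0 x \<le> l0 xs" "\<not> supp xs \<subseteq> supp x"
    define k where "k = card (supp xs - supp x)"
    have k1: "1 \<le> real k"
      using x(2) by (simp add: k_def Suc_le_eq card_gt_0_iff)
    have "card (supp x - supp xs) \<le> l0 x"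
      unfolding l0_def by (simp add: card_mono)
    then have sz: "l0 (xs - x) \<le> 2 * T"
      using l0_diff_le[of xs x] x(1) by (simp add: T)
    have "real (l0 xs) - real (l0 x) \<le> real k"
      using l0_exchange[of xs x] by (simp add: k_def)
    then have "lam * (real (l0 xs) - real (l0 x)) \<le> lam * real k"
      using lam0 by simp
    also have "\<dots> < (c / 2 - \<beta> * sqrt c) * m\<^sup>2 * real k"
      using lamc k1 by (intro mult_strict_right_mono) auto
    also have "\<dots> = real k * m\<^sup>2 * (c / 2 - \<beta> * sqrt c)"
      by simp
    also have "\<dots> \<le> (norm (\<Psi> *v (xs - x)))\<^sup>2 / 2 - \<epsilon> * norm (\<Psi> *v (xs - x))"
    proof (rule noisy_energy_lower_bound)
      have "c * (real k * m\<^sup>2) \<le> c * (norm (xs - x))\<^sup>2"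
        unfolding k_def using norm_diff_ge_card_missed[of xs m x] m c by (intro mult_left_mono) auto
      also have "\<dots> \<le> (norm (\<Psi> *v (xs - x)))\<^sup>2"
        using sz by (rule low)
      finally show "c * (real k * m\<^sup>2) \<le> (norm (\<Psi> *v (xs - x)))\<^sup>2" .
    qed (use k1 m \<beta> \<beta>c in auto)
    finally show "lam * (real (l0 xs) - real (l0 x))
        < (norm (\<Psi> *v (xs - x)))\<^sup>2 / 2 - \<epsilon> * norm (\<Psi> *v (xs - x))" .
  qed
qed

theorem theorem2p1:
  fixes \<Psi> :: "real^'p^'n" and xs :: "real^'p" and \<eta> y :: "real^'n"
    and \<epsilon> \<beta> m :: real and T :: nat
  assumes "CARD('n) < CARD('p)"
    and "\<And>i. norm (column i \<Psi>) = 1"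
    and "T = card (supp xs)" and "T \<ge> 1"
    and "m = Min ((\<lambda>i. \<bar>xs $ i\<bar>) ` supp xs)"
    and "\<epsilon> \<ge> 0" and "norm \<eta> \<le> \<epsilon>"
    and "y = (\<Sum>i\<in>supp xs. (xs $ i) *\<^sub>R column i \<Psi>) + \<eta>"
    and "0 \<le> \<beta>" and "\<beta> < 1/2"
    and "\<epsilon> \<le> \<beta> * m"
  shows
    "(let \<nu> = mutual_coherence \<Psi>;
          \<xi> = (1 - 2 * (real T - 1) * \<nu> - 2 * \<beta> - \<beta>\<^sup>2) / (2 * real T) * m\<^sup>2
      in \<nu> < (1 - 2 * \<beta>) / (3 * real T - 1) \<and>
         \<beta> \<le> (1 - 2 * (real T - 1) * \<nu>) / (real T + 3) \<longrightarrow>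
         (\<forall>lam. \<epsilon>\<^sup>2 / 2 < lam \<and> lam < \<xi> \<longrightarrow>
           {x. is_arg_min (J \<Psi> y lam) (\<lambda>_. True) x} = {oracle_solution \<Psi> (supp xs) y})) \<and>
     (let \<delta> = rip_const \<Psi> (2 * T);
          \<xi> = (1/2 * (1 - \<delta>) - \<delta>\<^sup>2 / (1 - \<delta>) - \<beta> / sqrt (1 - \<delta>) - 1/2 * \<beta>\<^sup>2) * m\<^sup>2
      in \<delta> \<le> (1 - 2 * \<beta>) / (2 * sqrt (real T) + 1) \<and>
         \<beta> \<le> (1 - 2 * \<delta> - \<delta>\<^sup>2) / 4 \<longrightarrow>
         (\<forall>lam. \<epsilon>\<^sup>2 / 2 < lam \<and> lam < \<xi> \<longrightarrow>
           {x. is_arg_min (J \<Psi> y lam) (\<lambda>_. True) x} = {oracle_solution \<Psi> (supp xs) y}))"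
proof -
  have y: "y = \<Psi> *v xs + \<eta>"
    using assms(8) matrix_vector_mult_eq_sum_supp[of xs "supp xs" \<Psi>] by simp
  have T: "T = l0 xs"
    using assms(3) by (simp add: l0_def)
  have "supp xs \<noteq> {}"
    using assms(3,4) by auto
  then have m: "0 < m" "\<And>i. i \<in> supp xs \<Longrightarrow> m \<le> \<bar>xs $ i\<bar>"
    unfolding assms(5) by (auto simp: supp_def)
  \<comment> \<open>Index types are nonempty, so p > n forces at least two columns and the coherence
    is a maximum over a nonempty set.\<close>
  have "0 < CARD('n)" by simp
  then have card: "CARD('p) > 1"
    using assms(1) by linarith
  have rip: "rip_bound \<Psi> (2 * T) (rip_const \<Psi> (2 * T))"
    using assms(4) by (intro rip_const_least) simp
  show ?thesis
    unfolding Let_def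
    using oracle_unique_minimizer_coherence[OF card assms(2) y assms(7) T assms(4) m assms(9-11)]
      oracle_unique_minimizer_rip[OF rip y assms(7) T assms(4) m assms(9-11)]
    by blast
qed

end
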